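(* Let $\mu$ be a probability measure on $\mathbb{R}^d$ that is absolutely continuous with respect to Lebesgue measure and let $t>0$. For $s\ge 0$ let $\Pi_s$ denote the convex hull of the points of a Poisson point process on $\mathbb{R}^d$ with intensity measure $s\mu$, let $N(\Pi_s)$ be the number of vertices of $\Pi_s$, and let $\Delta(\Pi_s)=\mu(\mathbb{R}^d\setminus\Pi_s)$. Then for every $x\in[0,1]$, $$g_{N(\Pi_t)}(x)=h_{\Delta(\Pi_{xt})}(t(x-1)),$$ where $g_X(z)=\mathbb{E}\, z^X$ is the generating function and $h_X(z)=\mathbb{E}\, e^{zX}$ the moment generating function of a random variable $X$.
   Context: A Poisson point process with intensity measure $s\mu$ is a random finite simple counting measure $\eta$ such that $\eta(A)$ is Poisson distributed with parameter $s\mu(A)$ for every Borel set $A$ and counts of pairwise disjoint Borel sets are independent. The convex hull of the empty set is empty. *)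

theory Defs
  imports "HOL-Probability.Probability"
begin

definition poisson_point_process ::
  "'w measure \<Rightarrow> ('w \<Rightarrow> 'a::euclidean_space set) \<Rightarrow> 'a measure \<Rightarrow> real \<Rightarrow> bool" where
  "poisson_point_process M eta mu s \<longleftrightarrow>
     prob_space M \<and>
     (\<forall>w\<in>space M. finite (eta w)) \<and>
     (\<forall>A\<in>sets borel.
        (\<lambda>w. card (eta w \<inter> A)) \<in> measurable M (count_space UNIV) \<and>
        (\<forall>k::nat. measure M {w\<in>space M. card (eta w \<inter> A) = k}
                   = (s * measure mu A) ^ k / fact k * exp (- (s * measure mu A)))) \<and>
     (\<forall>(As :: nat \<Rightarrow> 'a set) I.
        (\<forall>i\<in>I. As i \<in> sets borel) \<and> disjoint_family_on As I \<longrightarrow>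
        prob_space.indep_vars M (\<lambda>_. count_space UNIV) (\<lambda>i w. card (eta w \<inter> As i)) I)"

definition num_vertices :: "'a::euclidean_space set \<Rightarrow> nat" where
  "num_vertices P = card {v. v extreme_point_of (convex hull P)}"

definition missed_mass :: "'a::euclidean_space measure \<Rightarrow> 'a set \<Rightarrow> real" where
  "missed_mass mu P = measure mu (UNIV - convex hull P)"

end

theory Submission
  imports Defs
begin

text \<open>
  Couple the two processes by marking: take a Poisson(t) number of independent points with law mu
  and keep each one independently with probability x.  The kept points K and the deleted points D
  are independent Poisson processes with intensities x t mu and (1 - x) t mu, and their union has
  intensity t mu.  Almost surely the points are distinct, and then D lies in the hull of K iff every
  vertex of the hull of the union was kept.  Conditioning on the union, this event has probability
  E x^N; conditioning on K, it has probability E exp (- (1 - x) t Delta).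

  Laws of finite random sets are compared through their void probabilities (Renyi): the events
  ``no point in A'' are stable under intersection, and they generate the sigma-algebra of
  finite configurations.
\<close>

section \<open>Convex hulls and their vertices\<close>

abbreviation vertices :: "'a::real_vector set \<Rightarrow> 'a set" where
  "vertices S \<equiv> {v. v extreme_point_of (convex hull S)}"

lemma vertices_subset_iff_subset_hull:
  fixes S :: "'a::euclidean_space set"
  assumes "compact S" and "K \<subseteq> S"
  shows "vertices S \<subseteq> K \<longleftrightarrow> S \<subseteq> convex hull K"
proof
  assume "vertices S \<subseteq> K"
  have "S \<subseteq> convex hull S" by (rule hull_subset)
  also have "convex hull S = convex hull (vertices S)"
    using \<open>compact S\<close> by (intro Krein_Milman_Minkowski compact_convex_hull convex_convex_hull)
  also have "\<dots> \<subseteq> convex hull K"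
    using \<open>vertices S \<subseteq> K\<close> by (rule hull_mono)
  finally show "S \<subseteq> convex hull K" .
next
  assume "S \<subseteq> convex hull K"
  then have "convex hull S = convex hull K"
    using \<open>K \<subseteq> S\<close> by (intro subset_antisym hull_mono hull_minimal) auto
  then show "vertices S \<subseteq> K"
    using extreme_points_of_convex_hull[of K] by simp
qed

lemma separating_hyperplane_in_dense:
  fixes P :: "('a::euclidean_space \<times> real) set"
  assumes dense: "\<And>X. open X \<Longrightarrow> X \<noteq> {} \<Longrightarrow> \<exists>p\<in>P. p \<in> X"
    and "finite K" and "z \<notin> convex hull K"
  shows "\<exists>(a, b)\<in>P. (\<forall>y\<in>K. a \<bullet> y < b) \<and> b < a \<bullet> z"
proof -
  let ?X = "(\<Inter>y\<in>K. {p. fst p \<bullet> y < snd p}) \<inter> {p::'a \<times> real. snd p < fst p \<bullet> z}"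
  have "open ?X"
    using \<open>finite K\<close>
    by (intro open_Int open_INT ballI open_Collect_less) (auto intro!: continuous_intros)
  moreover obtain a b where "a \<bullet> z < b" "\<forall>y\<in>convex hull K. b < a \<bullet> y"
    using separating_hyperplane_closed_point[of "convex hull K" z] assms(2,3)
    by (auto simp: finite_imp_compact_convex_hull compact_imp_closed)
  then have "(- a, - b) \<in> ?X"
    by (auto simp: hull_inc)
  ultimately obtain p where "p \<in> P" "p \<in> ?X"
    using dense by blast
  then show ?thesis
    by (intro bexI[of _ p]) auto
qed

lemma countable_open_determining_hulls:
  obtains C :: "'a::euclidean_space set set" where "countable C" and "\<And>H. H \<in> C \<Longrightarrow> open H"
    and "\<And>K D. finite K \<Longrightarrow> D \<subseteq> convex hull K \<longleftrightarrow> (\<forall>H\<in>C. K \<inter> H = {} \<longrightarrow> D \<inter> H = {})"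
proof -
  define halfspace :: "'a \<times> real \<Rightarrow> 'a set" where "halfspace = (\<lambda>(a, b). {y. b < a \<bullet> y})"
  obtain P :: "('a \<times> real) set"
    where "countable P" and dense: "\<And>X. open X \<Longrightarrow> X \<noteq> {} \<Longrightarrow> \<exists>p\<in>P. p \<in> X"
    by (rule countable_dense_setE) blast
  have separated: "\<exists>p\<in>P. K \<inter> halfspace p = {} \<and> z \<in> halfspace p"
    if not_in_hull: "finite K" "z \<notin> convex hull K" for K z
  proof -
    obtain a b where "(a, b) \<in> P" "\<forall>y\<in>K. a \<bullet> y < b" "b < a \<bullet> z"
      using separating_hyperplane_in_dense[of P K z] dense not_in_hull by blast
    then show ?thesis
      by (intro bexI[of _ "(a, b)"]) (auto simp: halfspace_def)
  qed
  have "convex (- halfspace p)" for p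
    using convex_halfspace_le[of "fst p" "snd p"]
    by (simp add: halfspace_def case_prod_unfold Collect_neg_eq[symmetric] not_less)
  then have hull_avoids: "convex hull K \<inter> halfspace p = {}" if "K \<inter> halfspace p = {}" for K p
    using hull_minimal[of K "- halfspace p" convex] that by blast
  show thesis
  proof
    show "countable (halfspace ` P)"
      using \<open>countable P\<close> by (rule countable_image)
    show "open H" if "H \<in> halfspace ` P" for H
      using that by (auto simp: halfspace_def intro!: open_Collect_less continuous_intros)
    show "D \<subseteq> convex hull K \<longleftrightarrow> (\<forall>H\<in>halfspace ` P. K \<inter> H = {} \<longrightarrow> D \<inter> H = {})"
      if "finite K" for K D
    proof safe
      fix p z assume "D \<subseteq> convex hull K" "K \<inter> halfspace p = {}" "z \<in> D" "z \<in> halfspace p"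
      then show "z \<in> {}"
        using hull_avoids[of K p] by blast
    next
      fix z assume "\<forall>H\<in>halfspace ` P. K \<inter> H = {} \<longrightarrow> D \<inter> H = {}" "z \<in> D"
      then show "z \<in> convex hull K"
        using separated[OF that, of z] by blast
    qed
  qed
qed

section \<open>The measurable space of finite configurations\<close>

definition void :: "'a set \<Rightarrow> 'a set set" where
  "void A = {S. finite S \<and> S \<inter> A = {}}"

definition config :: "'a::topological_space set measure" where
  "config = sigma {S. finite S} (void ` sets borel)"

lemma void_image_subset_Pow: "void ` X \<subseteq> Pow {S. finite S}"
  by (auto simp: void_def)

lemma space_config [simp]: "space config = {S. finite S}"
  by (simp add: config_def space_measure_of void_image_subset_Pow)

lemma sets_config: "sets config = sigma_sets {S. finite S} (void ` sets borel)"
  by (simp add: config_def sets_measure_of void_image_subset_Pow)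

lemma void_in_sets_config [measurable, simp]: "A \<in> sets borel \<Longrightarrow> void A \<in> sets config"
  by (auto simp: sets_config)

lemma void_empty: "void {} = {S. finite S}"
  by (simp add: void_def)

lemma void_Int_void: "void A \<inter> void B = void (A \<union> B)"
  by (auto simp: void_def)

lemma measurable_configI:
  assumes "\<And>w. w \<in> space M \<Longrightarrow> finite (f w)"
    and "\<And>A. A \<in> sets borel \<Longrightarrow> {w\<in>space M. f w \<inter> A = {}} \<in> sets M"
  shows "f \<in> measurable M config"
  unfolding config_def
proof (rule measurable_measure_of)
  fix Y assume "Y \<in> void ` sets (borel :: 'b measure)"
  then obtain A where "A \<in> sets borel" "Y = void A" by auto
  moreover have "f -` void A \<inter> space M = {w\<in>space M. f w \<inter> A = {}}"
    using assms(1) by (auto simp: void_def)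
  ultimately show "f -` Y \<inter> space M \<in> sets M"
    using assms(2) by simp
qed (use assms(1) in \<open>auto simp: void_image_subset_Pow\<close>)

lemma measurable_Diff_config [measurable (raw)]:
  assumes [measurable]: "f \<in> measurable M config" and "U \<in> sets borel"
  shows "(\<lambda>w. f w - U) \<in> measurable M config"
proof (rule measurable_configI)
  show "finite (f w - U)" if "w \<in> space M" for w
    using measurable_space[OF assms(1) that] by simp
  fix A :: "'b set" assume "A \<in> sets borel"
  then have [measurable]: "void (A - U) \<in> sets config"
    using assms(2) by simp
  have "{w \<in> space M. f w \<in> void (A - U)} \<in> sets M" by measurable
  also have "{w \<in> space M. f w \<in> void (A - U)} = {w \<in> space M. (f w - U) \<inter> A = {}}"
    using measurable_space[OF assms(1)] by (auto simp: void_def)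
  finally show "{w \<in> space M. (f w - U) \<inter> A = {}} \<in> sets M" .
qed

lemma measurable_Un_config [measurable (raw)]:
  assumes [measurable]: "f \<in> measurable M config" "g \<in> measurable M config"
  shows "(\<lambda>w. f w \<union> g w) \<in> measurable M config"
proof (rule measurable_configI)
  note finite = measurable_space[OF assms(1), simplified] measurable_space[OF assms(2), simplified]
  show "finite (f w \<union> g w)" if "w \<in> space M" for w
    using finite that by simp
  fix A :: "'b set" assume [measurable]: "A \<in> sets borel"
  have "{w \<in> space M. f w \<in> void A \<and> g w \<in> void A} \<in> sets M" by measurable
  also have "{w \<in> space M. f w \<in> void A \<and> g w \<in> void A} = {w \<in> space M. (f w \<union> g w) \<inter> A = {}}"
    using finite by (auto simp: void_def)
  finally show "{w \<in> space M. (f w \<union> g w) \<inter> A = {}} \<in> sets M" .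
qed

lemma measurable_image_config [measurable (raw)]:
  assumes "finite I" and [measurable]: "\<And>i. i \<in> I \<Longrightarrow> f i \<in> borel_measurable M"
    "\<And>i. i \<in> I \<Longrightarrow> Measurable.pred M (P i)"
  shows "(\<lambda>w. (\<lambda>i. f i w) ` {i\<in>I. P i w}) \<in> measurable M config"
proof (rule measurable_configI)
  show "finite ((\<lambda>i. f i w) ` {i\<in>I. P i w})" for w
    using \<open>finite I\<close> by simp
  fix A :: "'c set" assume [measurable]: "A \<in> sets borel"
  have "{w \<in> space M. \<forall>i\<in>I. P i w \<longrightarrow> f i w \<notin> A} \<in> sets M"
    using \<open>finite I\<close> by measurable
  also have "{w \<in> space M. \<forall>i\<in>I. P i w \<longrightarrow> f i w \<notin> A}
      = {w \<in> space M. (\<lambda>i. f i w) ` {i\<in>I. P i w} \<inter> A = {}}"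
    by auto
  finally show "{w \<in> space M. (\<lambda>i. f i w) ` {i\<in>I. P i w} \<inter> A = {}} \<in> sets M" .
qed

lemma measurable_singleton_config [measurable]: "(\<lambda>y. {y}) \<in> measurable borel config"
  by (rule measurable_configI) auto

lemma config_measure_eqI:
  fixes P Q :: "'a::topological_space set measure"
  assumes "sets P = sets config" and "sets Q = sets config" and "finite_measure P"
    and "\<And>A. A \<in> sets borel \<Longrightarrow> emeasure P (void A) = emeasure Q (void A)"
  shows "P = Q"
proof (rule measure_eqI_generator_eq)
  show "Int_stable (void ` sets (borel :: 'a measure))"
    by (auto simp: Int_stable_def void_Int_void)
  show "range (\<lambda>i::nat. void {}) \<subseteq> void ` sets (borel :: 'a measure)" by auto
  show "emeasure P (void {}) \<noteq> \<infinity>"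
    using assms(3) by (simp add: finite_measure.emeasure_finite)
qed (use assms in \<open>auto simp: sets_config void_empty void_image_subset_Pow\<close>)

lemma config_pair_measure_eqI:
  fixes P Q :: "('a::topological_space set \<times> 'b::topological_space set) measure"
  assumes P: "sets P = sets (config \<Otimes>\<^sub>M config)" and Q: "sets Q = sets (config \<Otimes>\<^sub>M config)"
    and "finite_measure P"
    and eq: "\<And>A B. A \<in> sets borel \<Longrightarrow> B \<in> sets borel \<Longrightarrow>
               emeasure P (void A \<times> void B) = emeasure Q (void A \<times> void B)"
  shows "P = Q"
proof (rule measure_eqI_generator_eq)
  let ?F = "{S :: 'a set. finite S} \<times> {S :: 'b set. finite S}"
  let ?V = "void ` sets (borel :: 'a measure)" and ?W = "void ` sets (borel :: 'b measure)"
  let ?E = "{a \<times> b | a b. a \<in> ?V \<and> b \<in> ?W}"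
  have "void {} \<in> ?V" "void {} \<in> ?W" by auto
  then have generated: "sets (config \<Otimes>\<^sub>M config) = sets (sigma ?F ?E)"
    using sets_pair_eq[of ?V config "{void {}}" ?W config "{void {}}"]
    by (simp add: void_image_subset_Pow sets_config void_empty)
  show subset: "?E \<subseteq> Pow ?F"
    by (auto simp: void_def)
  show "sets P = sigma_sets ?F ?E" "sets Q = sigma_sets ?F ?E"
    using generated P Q subset by (simp_all add: sets_measure_of)
  show "Int_stable ?E"
  proof (rule Int_stableI)
    fix x y assume "x \<in> ?E" "y \<in> ?E"
    then obtain A B A' B' where
      "A \<in> sets borel" "B \<in> sets borel" "A' \<in> sets borel" "B' \<in> sets borel"
      "x = void A \<times> void B" "y = void A' \<times> void B'" by blast
    moreover from this have "x \<inter> y = void (A \<union> A') \<times> void (B \<union> B')"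
      by (simp add: Times_Int_Times void_Int_void)
    ultimately show "x \<inter> y \<in> ?E" by blast
  qed
  show "range (\<lambda>i::nat. void {} \<times> void {}) \<subseteq> ?E"
    by blast
  show "emeasure P (void {} \<times> void {}) \<noteq> \<infinity>"
    using assms(3) by (simp add: finite_measure.emeasure_finite)
qed (use eq in \<open>auto simp: void_empty\<close>)

section \<open>Measurability of the number of vertices and of the missed mass\<close>

lemma Suc_le_card_iff_topological_basis:
  fixes S :: "'a::t1_space set"
  assumes "finite S" and "topological_basis B"
  shows "Suc k \<le> card S \<longleftrightarrow> (\<exists>U\<in>B. S \<inter> U \<noteq> {} \<and> k \<le> card (S - U))"
proof
  assume card: "Suc k \<le> card S"
  then obtain v where "v \<in> S" by fastforce
  have "open (- (S - {v}))"
    using \<open>finite S\<close> by (intro open_Compl finite_imp_closed) auto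
  then obtain U where U: "U \<in> B" "v \<in> U" "U \<subseteq> - (S - {v})"
    using topological_basisE[OF assms(2), of "- (S - {v})" v] by auto
  then have "S - U = S - {v}"
    using \<open>v \<in> S\<close> by auto
  then show "\<exists>U\<in>B. S \<inter> U \<noteq> {} \<and> k \<le> card (S - U)"
    using U \<open>v \<in> S\<close> card \<open>finite S\<close> by (intro bexI[of _ U]) auto
next
  assume "\<exists>U\<in>B. S \<inter> U \<noteq> {} \<and> k \<le> card (S - U)"
  then obtain U where "S \<inter> U \<noteq> {}" "k \<le> card (S - U)" by blast
  moreover from this have "card (S - U) < card S"
    using \<open>finite S\<close> by (intro psubset_card_mono) auto
  ultimately show "Suc k \<le> card S" by simp
qed

lemma measurable_card_config [measurable]:
  "(card :: 'a::{second_countable_topology, t1_space} set \<Rightarrow> nat)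
     \<in> measurable config (count_space UNIV)"
proof -
  obtain B :: "'a set set" where B: "countable B" "topological_basis B"
    using ex_countable_basis by blast
  have at_least: "{S \<in> space config. k \<le> card (S :: 'a set)} \<in> sets config" for k
  proof (induction k)
    case 0
    show ?case using sets.top[of "config :: 'a set measure"] by simp
  next
    case (Suc k)
    have "{S \<in> space config. Suc k \<le> card S}
        = (\<Union>U\<in>B. {S \<in> space config. S - U \<in> {S \<in> space config. k \<le> card S}} - void U)"
      by (auto simp: Suc_le_card_iff_topological_basis[OF _ B(2)] void_def; blast)
    also have "\<dots> \<in> sets config"
    proof (intro sets.countable_UN'' B(1) sets.Diff)
      fix U assume "U \<in> B"
      then have "U \<in> sets borel"
        using B(2) by (simp add: topological_basis_open)
      note [measurable] = this Suc
      show "void U \<in> sets config"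
        and "{S \<in> space config. S - U \<in> {S \<in> space config. k \<le> card S}} \<in> sets config"
        by measurable
    qed
    finally show ?case .
  qed
  have exactly: "card -` {k} \<inter> space config
      = {S \<in> space config. k \<le> card S} - {S \<in> space config. Suc k \<le> card (S :: 'a set)}" for k
    by auto
  have "card -` {k} \<inter> space config \<in> sets (config :: 'a set measure)" for k
    unfolding exactly by (intro sets.Diff at_least)
  then show ?thesis
    by (subst measurable_count_space_eq2_countable) auto
qed

definition hull_covers :: "('a::real_vector set \<times> 'a set) set" where
  "hull_covers = {(K, D). finite K \<and> finite D \<and> D \<subseteq> convex hull K}"

lemma hull_covers_iff_vertices:
  fixes K D :: "'a::euclidean_space set"
  assumes "finite K" and "finite D"
  shows "(K, D) \<in> hull_covers \<longleftrightarrow> vertices (K \<union> D) \<subseteq> K"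
  using assms vertices_subset_iff_subset_hull[of "K \<union> D" K] hull_subset[of K convex]
  by (auto simp: hull_covers_def finite_imp_compact)

lemma sets_hull_covers [measurable]:
  "(hull_covers :: ('a::euclidean_space set \<times> 'a set) set) \<in> sets (config \<Otimes>\<^sub>M config)"
proof -
  obtain C :: "'a set set" where C: "countable C" "\<And>H. H \<in> C \<Longrightarrow> open H"
    "\<And>K D. finite K \<Longrightarrow> D \<subseteq> convex hull K \<longleftrightarrow> (\<forall>H\<in>C. K \<inter> H = {} \<longrightarrow> D \<inter> H = {})"
    using countable_open_determining_hulls by blast
  have "(K, D) \<in> hull_covers
      \<longleftrightarrow> finite K \<and> finite D \<and> (\<forall>H\<in>C. K \<in> void H \<longrightarrow> D \<in> void H)" for K D
    using C(3)[of K D] by (auto simp: hull_covers_def void_def)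
  then have "hull_covers
      = space (config \<Otimes>\<^sub>M config) - (\<Union>H\<in>C. void H \<times> (space config - void H))"
    by (auto simp: space_pair_measure)
  also have "\<dots> \<in> sets (config \<Otimes>\<^sub>M config)"
    using C(1,2)
    by (intro sets.Diff sets.top sets.countable_UN'' pair_measureI void_in_sets_config) auto
  finally show ?thesis .
qed

lemma measurable_vertices [measurable]:
  "(vertices :: 'a::euclidean_space set \<Rightarrow> 'a set) \<in> measurable config config"
proof (rule measurable_configI)
  show "finite (vertices S)" if "S \<in> space config" for S :: "'a set"
    using that by (auto intro: finite_subset[OF extreme_points_of_convex_hull])
  fix U :: "'a set" assume U [measurable]: "U \<in> sets borel"
  have "vertices S \<inter> U = {} \<longleftrightarrow> (S - U, S) \<in> hull_covers" if "finite S" for S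
    using that extreme_points_of_convex_hull[of S]
    by (auto simp: hull_covers_iff_vertices Un_absorb1)
  then have "{S \<in> space config. vertices S \<inter> U = {}}
      = {S \<in> space config. (S - U, S) \<in> hull_covers}"
    by auto
  also have "\<dots> \<in> sets config" by measurable
  finally show "{S \<in> space config. vertices S \<inter> U = {}} \<in> sets config" .
qed

lemma measurable_num_vertices [measurable]:
  "num_vertices \<in> measurable config (count_space UNIV)"
  unfolding num_vertices_def[abs_def] by measurable

lemma measurable_missed_mass:
  fixes mu :: "'a::euclidean_space measure"
  assumes "sigma_finite_measure mu" and [measurable_cong]: "sets mu = sets borel"
  shows "missed_mass mu \<in> borel_measurable config"
proof -
  interpret sigma_finite_measure mu by fact
  let ?missed = "{p \<in> space (config \<Otimes>\<^sub>M mu). (fst p, {snd p}) \<notin> hull_covers}"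
  have "?missed \<in> sets (config \<Otimes>\<^sub>M mu)" by measurable
  then have "(\<lambda>K. measure mu (Pair K -` ?missed)) \<in> borel_measurable config"
    unfolding measure_def by (intro borel_measurable_enn2real measurable_emeasure_Pair)
  moreover have "measure mu (Pair K -` ?missed) = missed_mass mu K" if "K \<in> space config" for K
  proof -
    have "Pair K -` ?missed = UNIV - convex hull K"
      using that sets_eq_imp_space_eq[OF assms(2)]
      by (auto simp: hull_covers_def space_pair_measure)
    then show ?thesis
      by (simp add: missed_mass_def)
  qed
  ultimately show ?thesis
    by (rule measurable_cong[THEN iffD1, rotated])
qed

section \<open>Void probabilities of Poisson processes\<close>

text \<open>For diffuse mu this singles out the Poisson process with intensity s mu, by Renyi's theorem.\<close>

definition poisson_law :: "'a::topological_space measure \<Rightarrow> real \<Rightarrow> 'a set measure \<Rightarrow> bool" where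
  "poisson_law mu s P \<longleftrightarrow> sets P = sets config \<and>
     (\<forall>A\<in>sets borel. emeasure P (void A) = ennreal (exp (- (s * measure mu A))))"

lemma poisson_law_sets: "poisson_law mu s P \<Longrightarrow> sets P = sets config"
  by (simp add: poisson_law_def)

lemma poisson_law_emeasure_void:
  "poisson_law mu s P \<Longrightarrow> A \<in> sets borel \<Longrightarrow>
     emeasure P (void A) = ennreal (exp (- (s * measure mu A)))"
  by (simp add: poisson_law_def)

lemma poisson_law_prob_space:
  assumes "poisson_law mu s P"
  shows "prob_space P"
proof
  have "space P = void {}"
    using sets_eq_imp_space_eq[OF poisson_law_sets[OF assms]] by (simp add: void_empty)
  then show "emeasure P (space P) = 1"
    using poisson_law_emeasure_void[OF assms, of "{}"] by simp
qed

lemma poisson_law_unique: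
  assumes "poisson_law mu s P" and "poisson_law mu s Q"
  shows "P = Q"
  using assms poisson_law_prob_space[OF assms(1)]
  by (intro config_measure_eqI) (auto simp: poisson_law_def prob_space_def)

lemma poisson_point_process_measurable:
  assumes "poisson_point_process M eta mu s"
  shows "eta \<in> measurable M config"
proof (rule measurable_configI)
  show finite: "finite (eta w)" if "w \<in> space M" for w
    using assms that by (simp add: poisson_point_process_def)
  fix A :: "'b set" assume "A \<in> sets borel"
  then have [measurable]: "(\<lambda>w. card (eta w \<inter> A)) \<in> measurable M (count_space UNIV)"
    using assms by (simp add: poisson_point_process_def)
  have "{w \<in> space M. card (eta w \<inter> A) = 0} \<in> sets M" by measurable
  also have "{w \<in> space M. card (eta w \<inter> A) = 0} = {w \<in> space M. eta w \<inter> A = {}}"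
    using finite by auto
  finally show "{w \<in> space M. eta w \<inter> A = {}} \<in> sets M" .
qed

lemma poisson_law_distr_poisson_point_process:
  fixes mu :: "'a::euclidean_space measure"
  assumes process: "poisson_point_process M eta mu s"
  shows "poisson_law mu s (distr M config eta)"
  unfolding poisson_law_def
proof safe
  interpret prob_space M
    using process by (simp add: poisson_point_process_def)
  fix A :: "'a set" assume A: "A \<in> sets borel"
  then have "prob {w \<in> space M. card (eta w \<inter> A) = 0}
      = (s * measure mu A) ^ 0 / fact 0 * exp (- (s * measure mu A))"
    using process unfolding poisson_point_process_def by blast
  moreover have "eta -` void A \<inter> space M = {w \<in> space M. card (eta w \<inter> A) = 0}"
    using process by (auto simp: void_def poisson_point_process_def)
  ultimately show "emeasure (distr M config eta) (void A) = ennreal (exp (- (s * measure mu A)))"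
    using A by (simp add: emeasure_distr[OF poisson_point_process_measurable[OF process]]
        emeasure_eq_measure)
qed simp_all

lemma poisson_law_emeasure_hull_covers:
  fixes mu :: "'a::euclidean_space measure"
  assumes "poisson_law mu s Q" and "finite K"
  shows "emeasure Q (Pair K -` hull_covers) = ennreal (exp (- (s * missed_mass mu K)))"
proof -
  have "Pair K -` hull_covers = void (UNIV - convex hull K)"
    using \<open>finite K\<close> by (auto simp: hull_covers_def void_def)
  moreover have "UNIV - convex hull K \<in> sets borel"
    using \<open>finite K\<close> by (auto simp: finite_imp_compact_convex_hull compact_imp_closed)
  ultimately show ?thesis
    using poisson_law_emeasure_void[OF assms(1)] by (simp add: missed_mass_def)
qed

section \<open>Independent points\<close>

lemma (in product_prob_space) nn_integral_PiM_indicator_Collect: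
  assumes "J \<subseteq> I" and "finite J" and "\<And>i. i \<in> J \<Longrightarrow> E i \<in> sets (M i)"
  shows "(\<integral>\<^sup>+ X. indicator {X. \<forall>i\<in>J. X i \<in> E i} X \<partial>PiM I M) = (\<Prod>i\<in>J. emeasure (M i) (E i))"
proof -
  let ?E = "{X \<in> space (PiM I M). \<forall>i\<in>J. X i \<in> E i}"
  have [measurable]: "Measurable.pred (PiM I M) (\<lambda>X. X i \<in> E i)" if "i \<in> J" for i
    using that assms by (intro measurable_compose[OF measurable_component_singleton[of i I]]) auto
  have "(\<integral>\<^sup>+ X. indicator {X. \<forall>i\<in>J. X i \<in> E i} X \<partial>PiM I M) = (\<integral>\<^sup>+ X. indicator ?E X \<partial>PiM I M)"
    by (intro nn_integral_cong) (simp add: indicator_def)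
  also have "\<dots> = emeasure (PiM I M) ?E"
    using \<open>finite J\<close> by (intro nn_integral_indicator) measurable
  also have "\<dots> = (\<Prod>i\<in>J. emeasure (M i) (E i))"
    using assms by (rule emeasure_PiM_Collect)
  finally show ?thesis .
qed

lemma AE_PiM_neq:
  fixes M :: "'i \<Rightarrow> 'a::{second_countable_topology, t2_space} measure"
  assumes "product_sigma_finite M" and "finite I" and ij: "i \<in> I" "j \<in> I" "i \<noteq> j"
    and sets_M [measurable_cong]: "\<And>k. sets (M k) = sets borel"
    and diffuse: "\<And>y. emeasure (M i) {y} = 0"
  shows "AE X in PiM I M. X i \<noteq> X j"
proof -
  interpret product_sigma_finite M by fact
  have [measurable]: "(\<lambda>X. X k) \<in> borel_measurable (PiM I M)" if "k \<in> I" for k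
    using measurable_component_singleton[OF that, of M] measurable_cong_sets[OF refl sets_M]
    by blast
  let ?diagonal = "{X \<in> space (PiM I M). X i = X j}"
  have diagonal [measurable]: "?diagonal \<in> sets (PiM I M)"
    using ij by measurable
  have insert_i: "insert i (I - {i}) = I"
    using ij by auto
  have "emeasure (PiM I M) ?diagonal
      = (\<integral>\<^sup>+ X. \<integral>\<^sup>+ y. indicator ?diagonal (X(i := y)) \<partial>M i \<partial>PiM (I - {i}) M)"
    using product_nn_integral_insert[of "I - {i}" i "indicator ?diagonal", unfolded insert_i]
      \<open>finite I\<close> by simp
  also have "\<dots> \<le> (\<integral>\<^sup>+ X. \<integral>\<^sup>+ y. indicator {X j} y \<partial>M i \<partial>PiM (I - {i}) M)"
    using ij by (intro nn_integral_mono) (auto simp: indicator_def)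
  also have "\<dots> = 0"
    by (simp add: diffuse)
  finally have "emeasure (PiM I M) ?diagonal = 0" by simp
  then show ?thesis
    by (intro AE_I[OF _ _ diagonal]) auto
qed

lemma AE_PiM_inj_on:
  fixes M :: "'i \<Rightarrow> 'a::{second_countable_topology, t2_space} measure"
  assumes "product_sigma_finite M" and "finite I" and "\<And>k. sets (M k) = sets borel"
    and "\<And>k y. emeasure (M k) {y} = 0"
  shows "AE X in PiM I M. inj_on X I"
proof -
  have "AE X in PiM I M. \<forall>i\<in>I. \<forall>j\<in>I. i \<noteq> j \<longrightarrow> X i \<noteq> X j"
    using assms by (intro AE_finite_allI) (auto intro: AE_impI AE_PiM_neq)
  then show ?thesis
    by eventually_elim (auto simp: inj_on_def)
qed

lemma nn_integral_poisson_pmf_power: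
  assumes "0 < r" and "0 \<le> p"
  shows "(\<integral>\<^sup>+ n. ennreal (p ^ n) \<partial>measure_pmf (poisson_pmf r)) = ennreal (exp (r * (p - 1)))"
proof -
  have "(\<lambda>n. exp (- r) * ((r * p) ^ n /\<^sub>R fact n)) sums (exp (- r) * exp (r * p))"
    by (intro sums_mult exp_converges)
  then have sums: "(\<lambda>n. r ^ n / fact n * exp (- r) * p ^ n) sums exp (r * (p - 1))"
    by (simp add: power_mult_distrib divide_inverse mult_ac right_diff_distrib flip: exp_add)
  have "(\<integral>\<^sup>+ n. ennreal (p ^ n) \<partial>measure_pmf (poisson_pmf r))
      = (\<Sum>n. ennreal (r ^ n / fact n * exp (- r) * p ^ n))"
    using assms
    by (simp add: nn_integral_measure_pmf nn_integral_count_space_nat flip: ennreal_mult)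
  also have "\<dots> = ennreal (exp (r * (p - 1)))"
    using sums assms by (subst suminf_ennreal2) (auto simp: sums_iff)
  finally show ?thesis .
qed

lemma emeasure_bernoulli_pmf_notin_if:
  assumes "0 \<le> p" and "p \<le> 1"
  shows "emeasure (measure_pmf (bernoulli_pmf p)) {b. y \<notin> (if b then A else C)}
     = ennreal p * indicator (- A) y + ennreal (1 - p) * indicator (- C) y"
proof -
  have "emeasure (measure_pmf (bernoulli_pmf p)) {b. y \<notin> (if b then A else C)}
      = (\<integral>\<^sup>+ b. indicator {b. y \<notin> (if b then A else C)} b \<partial>measure_pmf (bernoulli_pmf p))"
    by simp
  also have "\<dots> = ennreal p * indicator (- A) y + ennreal (1 - p) * indicator (- C) y"
    using assms by (simp add: indicator_def del: nn_integral_indicator)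
  finally show ?thesis .
qed

section \<open>Thinning\<close>

definition thin :: "'i set \<Rightarrow> ('i \<Rightarrow> 'a) \<Rightarrow> ('i \<Rightarrow> bool) \<Rightarrow> 'a set \<times> 'a set" where
  "thin I X B = (X ` {i\<in>I. B i}, X ` {i\<in>I. \<not> B i})"

lemma Un_thin: "fst (thin I X B) \<union> snd (thin I X B) = X ` I"
  by (auto simp: thin_def)

lemma thin_in_void_iff:
  "finite I \<Longrightarrow> thin I X B \<in> void A \<times> void C \<longleftrightarrow> (\<forall>i\<in>I. X i \<notin> (if B i then A else C))"
  by (auto simp: thin_def void_def)

lemma thin_in_hull_covers_iff:
  fixes X :: "'i \<Rightarrow> 'a::euclidean_space"
  assumes "finite I" and "inj_on X I"
  shows "thin I X B \<in> hull_covers \<longleftrightarrow> (\<forall>i\<in>I. X i \<in> vertices (X ` I) \<longrightarrow> B i)"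
proof -
  have "thin I X B \<in> hull_covers \<longleftrightarrow> vertices (X ` I) \<subseteq> X ` {i\<in>I. B i}"
    using \<open>finite I\<close> hull_covers_iff_vertices[of "X ` {i\<in>I. B i}" "X ` {i\<in>I. \<not> B i}"]
      Un_thin[of I X B] by (simp add: thin_def)
  also have "\<dots> \<longleftrightarrow> (\<forall>i\<in>I. X i \<in> vertices (X ` I) \<longrightarrow> X i \<in> X ` {i\<in>I. B i})"
    using extreme_points_of_convex_hull[of "X ` I"] by blast
  also have "\<dots> \<longleftrightarrow> (\<forall>i\<in>I. X i \<in> vertices (X ` I) \<longrightarrow> B i)"
    using \<open>inj_on X I\<close> by (fastforce simp: inj_on_def)
  finally show ?thesis .
qed

lemma card_vertex_indices:
  fixes X :: "'i \<Rightarrow> 'a::euclidean_space"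
  assumes "inj_on X I"
  shows "card {i\<in>I. X i \<in> vertices (X ` I)} = num_vertices (X ` I)"
proof -
  have "X ` {i\<in>I. X i \<in> vertices (X ` I)} = vertices (X ` I)"
    using extreme_points_of_convex_hull[of "X ` I"] by blast
  moreover have "inj_on X {i\<in>I. X i \<in> vertices (X ` I)}"
    using assms by (rule inj_on_subset) auto
  ultimately show ?thesis
    unfolding num_vertices_def by (metis (no_types, lifting) card_image)
qed

locale poisson_thinning = prob_space mu for mu :: "'a::euclidean_space measure" +
  fixes t x :: real
  assumes sets_mu [simp, measurable_cong]: "sets mu = sets borel"
    and t_pos: "0 < t" and x_nonneg: "0 \<le> x" and x_le_1: "x \<le> 1"
begin

abbreviation points :: "nat \<Rightarrow> (nat \<Rightarrow> 'a) measure" where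
  "points n \<equiv> PiM {..<n} (\<lambda>_. mu)"

abbreviation marks :: "nat \<Rightarrow> (nat \<Rightarrow> bool) measure" where
  "marks n \<equiv> PiM {..<n} (\<lambda>_. measure_pmf (bernoulli_pmf x))"

sublocale points: product_prob_space "\<lambda>_. mu" "{..<n}" for n :: nat
  by (intro product_prob_spaceI prob_space_axioms)

sublocale marks: product_prob_space "\<lambda>_. measure_pmf (bernoulli_pmf x)" "{..<n}" for n :: nat
  by (intro product_prob_spaceI prob_space_measure_pmf)

definition thinned :: "nat \<Rightarrow> ('a set \<times> 'a set) measure" where
  "thinned n = distr (points n \<Otimes>\<^sub>M marks n) (config \<Otimes>\<^sub>M config) (\<lambda>(X, B). thin {..<n} X B)"

definition coupling :: "('a set \<times> 'a set) measure" where
  "coupling = measure_pmf (poisson_pmf t) \<bind> thinned"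

lemma measurable_thin [measurable]:
  "(\<lambda>(X, B). thin {..<n} X B) \<in> measurable (points n \<Otimes>\<^sub>M marks n) (config \<Otimes>\<^sub>M config)"
  unfolding thin_def case_prod_unfold by measurable

lemma nn_integral_thinned:
  assumes [measurable]: "f \<in> borel_measurable (config \<Otimes>\<^sub>M config)"
  shows "(\<integral>\<^sup>+ w. f w \<partial>thinned n) = (\<integral>\<^sup>+ X. \<integral>\<^sup>+ B. f (thin {..<n} X B) \<partial>marks n \<partial>points n)"
proof -
  have "(\<integral>\<^sup>+ w. f w \<partial>thinned n)
      = (\<integral>\<^sup>+ p. f (case p of (X, B) \<Rightarrow> thin {..<n} X B) \<partial>(points n \<Otimes>\<^sub>M marks n))"
    unfolding thinned_def by (intro nn_integral_distr) measurable
  also have "\<dots> = (\<integral>\<^sup>+ X. \<integral>\<^sup>+ B. f (thin {..<n} X B) \<partial>marks n \<partial>points n)"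
    by (subst marks.nn_integral_fst[symmetric]) simp_all
  finally show ?thesis .
qed

lemma measurable_thinned:
  "thinned \<in> measurable (measure_pmf p) (subprob_algebra (config \<Otimes>\<^sub>M config))"
proof -
  have "prob_space (thinned n)" for n
    unfolding thinned_def
    by (intro prob_space.prob_space_distr prob_space_pair points.prob_space_axioms
        marks.prob_space_axioms) measurable
  then show ?thesis
    by (auto simp: measurable_def space_subprob_algebra thinned_def
        intro: prob_space_imp_subprob_space)
qed

lemma sets_coupling [simp, measurable_cong]: "sets coupling = sets (config \<Otimes>\<^sub>M config)"
  unfolding coupling_def by (rule sets_bind) (simp_all add: thinned_def)

lemma space_coupling [simp]: "space coupling = {S. finite S} \<times> {S. finite S}"
  using sets_eq_imp_space_eq[OF sets_coupling] by (simp add: space_pair_measure)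

lemma nn_integral_coupling:
  "f \<in> borel_measurable (config \<Otimes>\<^sub>M config) \<Longrightarrow>
     (\<integral>\<^sup>+ w. f w \<partial>coupling)
     = (\<integral>\<^sup>+ n. \<integral>\<^sup>+ X. \<integral>\<^sup>+ B. f (thin {..<n} X B) \<partial>marks n \<partial>points n \<partial>measure_pmf (poisson_pmf t))"
  unfolding coupling_def
  by (simp add: nn_integral_bind[OF _ measurable_thinned] nn_integral_thinned)

subsection \<open>Kept and deleted points are independent Poisson processes\<close>

lemma nn_integral_indicator_mixture:
  assumes [measurable]: "A \<in> sets borel" "C \<in> sets borel"
  shows "(\<integral>\<^sup>+ y. ennreal x * indicator (- A) y + ennreal (1 - x) * indicator (- C) y \<partial>mu)
     = ennreal (x * (1 - measure mu A) + (1 - x) * (1 - measure mu C))"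
proof -
  have "emeasure mu (- E) = ennreal (1 - measure mu E)" if "E \<in> sets borel" for E
    using prob_compl[of E] sets_eq_imp_space_eq[OF sets_mu] that
    by (simp add: emeasure_eq_measure Compl_eq_Diff_UNIV)
  then show ?thesis
    using x_nonneg x_le_1
    by (simp add: nn_integral_add nn_integral_cmult flip: ennreal_mult ennreal_plus)
qed

lemma emeasure_coupling_void:
  assumes [measurable]: "A \<in> sets borel" "C \<in> sets borel"
  shows "emeasure coupling (void A \<times> void C)
     = ennreal (exp (- (x * t * measure mu A)) * exp (- ((1 - x) * t * measure mu C)))"
proof -
  define r where "r = x * (1 - measure mu A) + (1 - x) * (1 - measure mu C)"
  have "0 \<le> r"
    using x_nonneg x_le_1 by (simp add: r_def)
  have "(\<integral>\<^sup>+ X. \<integral>\<^sup>+ B. indicator (void A \<times> void C) (thin {..<n} X B) \<partial>marks n \<partial>points n)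
      = ennreal (r ^ n)" for n
  proof -
    let ?f = "\<lambda>y. ennreal x * indicator (- A) y + ennreal (1 - x) * indicator (- C) y"
    have "(\<integral>\<^sup>+ B. indicator (void A \<times> void C) (thin {..<n} X B) \<partial>marks n) = (\<Prod>i<n. ?f (X i))" for X
      using marks.nn_integral_PiM_indicator_Collect[of "{..<n}" n
          "\<lambda>i. {b. X i \<notin> (if b then A else C)}"]
        x_nonneg x_le_1
      by (simp add: thin_in_void_iff indicator_def emeasure_bernoulli_pmf_notin_if)
    then show ?thesis
      using points.product_nn_integral_prod[of "{..<n}" "\<lambda>_. ?f"]
        nn_integral_indicator_mixture[OF assms] \<open>0 \<le> r\<close>
      by (simp add: r_def ennreal_power)
  qed
  then have "emeasure coupling (void A \<times> void C) = ennreal (exp (t * (r - 1)))"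
    using nn_integral_coupling[of "indicator (void A \<times> void C)"] t_pos \<open>0 \<le> r\<close>
    by (simp add: nn_integral_poisson_pmf_power)
  then show ?thesis
    by (simp add: r_def algebra_simps flip: exp_add)
qed

lemma poisson_law_deleted: "poisson_law mu ((1 - x) * t) (distr coupling config snd)"
proof -
  have "snd -` void A \<inter> space coupling = void {} \<times> void A" for A :: "'a set"
    by (auto simp: void_def)
  then show ?thesis
    by (simp add: poisson_law_def emeasure_distr emeasure_coupling_void)
qed

lemma poisson_law_union: "poisson_law mu t (distr coupling config (\<lambda>w. fst w \<union> snd w))"
proof -
  have "(\<lambda>w. fst w \<union> snd w) -` void A \<inter> space coupling = void A \<times> void A" for A :: "'a set"
    by (auto simp: void_def)
  then show ?thesis
    by (simp add: poisson_law_def emeasure_distr emeasure_coupling_void algebra_simps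
        flip: exp_add)
qed

lemma coupling_eq_pair_measure:
  assumes P: "poisson_law mu (x * t) P" and Q: "poisson_law mu ((1 - x) * t) Q"
  shows "coupling = P \<Otimes>\<^sub>M Q"
proof (rule config_pair_measure_eqI[symmetric])
  interpret Q: prob_space Q by (rule poisson_law_prob_space[OF Q])
  show "finite_measure (P \<Otimes>\<^sub>M Q)"
    using prob_space_pair[OF poisson_law_prob_space[OF P] Q.prob_space_axioms]
    by (simp add: prob_space_def)
  show "emeasure (P \<Otimes>\<^sub>M Q) (void A \<times> void C) = emeasure coupling (void A \<times> void C)"
    if "A \<in> sets borel" "C \<in> sets borel" for A C
    using that P Q
    by (simp add: Q.emeasure_pair_measure_Times emeasure_coupling_void ennreal_mult
        poisson_law_sets poisson_law_emeasure_void)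
qed (simp_all add: sets_pair_measure_cong[OF poisson_law_sets[OF P] poisson_law_sets[OF Q]])

subsection \<open>Two evaluations of the probability that the kept points span the hull\<close>

lemma emeasure_coupling_hull_covers_missed_mass:
  assumes "poisson_law mu (x * t) P"
  shows "emeasure coupling hull_covers
     = (\<integral>\<^sup>+ K. ennreal (exp (t * (x - 1) * missed_mass mu K)) \<partial>P)"
proof -
  define Q where "Q = distr coupling config snd"
  have Q: "poisson_law mu ((1 - x) * t) Q"
    unfolding Q_def by (rule poisson_law_deleted)
  interpret Q: prob_space Q by (rule poisson_law_prob_space[OF Q])
  have "hull_covers \<in> sets (P \<Otimes>\<^sub>M Q)"
    using assms Q by (simp add: poisson_law_sets cong: sets_pair_measure_cong)
  then have "emeasure coupling hull_covers = (\<integral>\<^sup>+ K. emeasure Q (Pair K -` hull_covers) \<partial>P)"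
    by (simp add: coupling_eq_pair_measure[OF assms Q] Q.emeasure_pair_measure_alt)
  also have "\<dots> = (\<integral>\<^sup>+ K. ennreal (exp (t * (x - 1) * missed_mass mu K)) \<partial>P)"
  proof (rule nn_integral_cong)
    fix K assume "K \<in> space P"
    then have "finite K"
      using sets_eq_imp_space_eq[OF poisson_law_sets[OF assms]] by simp
    then show "emeasure Q (Pair K -` hull_covers) = ennreal (exp (t * (x - 1) * missed_mass mu K))"
      by (simp add: poisson_law_emeasure_hull_covers[OF Q] algebra_simps)
  qed
  finally show ?thesis .
qed

lemma nn_integral_marks_hull_covers:
  assumes "inj_on X {..<n}"
  shows "(\<integral>\<^sup>+ B. indicator hull_covers (thin {..<n} X B) \<partial>marks n)
     = ennreal (x ^ num_vertices (X ` {..<n}))"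
proof -
  let ?J = "{i \<in> {..<n}. X i \<in> vertices (X ` {..<n})}"
  have "(\<integral>\<^sup>+ B. indicator hull_covers (thin {..<n} X B) \<partial>marks n)
      = (\<integral>\<^sup>+ B. indicator {B. \<forall>i\<in>?J. B i \<in> {True}} B \<partial>marks n)"
    by (intro nn_integral_cong) (auto simp: indicator_def thin_in_hull_covers_iff[OF _ assms])
  also have "\<dots> = (\<Prod>i\<in>?J. emeasure (measure_pmf (bernoulli_pmf x)) {True})"
    by (rule marks.nn_integral_PiM_indicator_Collect) auto
  also have "\<dots> = ennreal (x ^ num_vertices (X ` {..<n}))"
    using x_nonneg x_le_1
    by (simp only: prod_constant card_vertex_indices[OF assms])
       (simp add: emeasure_pmf_single ennreal_power)
  finally show ?thesis .
qed

lemma emeasure_coupling_hull_covers_num_vertices: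
  assumes diffuse: "\<And>y. emeasure mu {y} = 0" and "poisson_law mu t P"
  shows "emeasure coupling hull_covers = (\<integral>\<^sup>+ S. ennreal (x ^ num_vertices S) \<partial>P)"
proof -
  have "(\<integral>\<^sup>+ X. \<integral>\<^sup>+ B. indicator hull_covers (thin {..<n} X B) \<partial>marks n \<partial>points n)
      = (\<integral>\<^sup>+ X. \<integral>\<^sup>+ B. ennreal (x ^ num_vertices (fst (thin {..<n} X B) \<union> snd (thin {..<n} X B)))
          \<partial>marks n \<partial>points n)" for n
  proof (rule nn_integral_cong_AE)
    have "AE X in points n. inj_on X {..<n}"
      using diffuse by (intro AE_PiM_inj_on points.product_sigma_finite_axioms) auto
    then show "AE X in points n. (\<integral>\<^sup>+ B. indicator hull_covers (thin {..<n} X B) \<partial>marks n)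
        = (\<integral>\<^sup>+ B. ennreal (x ^ num_vertices (fst (thin {..<n} X B) \<union> snd (thin {..<n} X B)))
            \<partial>marks n)"
      by eventually_elim
        (simp add: nn_integral_marks_hull_covers Un_thin marks.emeasure_space_1)
  qed
  then have "emeasure coupling hull_covers
      = (\<integral>\<^sup>+ w. ennreal (x ^ num_vertices (fst w \<union> snd w)) \<partial>coupling)"
    using nn_integral_coupling[of "indicator hull_covers"] by (simp add: nn_integral_coupling)
  also have "\<dots> = (\<integral>\<^sup>+ S. ennreal (x ^ num_vertices S) \<partial>distr coupling config (\<lambda>w. fst w \<union> snd w))"
    by (intro nn_integral_distr[symmetric]) measurable
  also have "distr coupling config (\<lambda>w. fst w \<union> snd w) = P"
    by (rule poisson_law_unique[OF poisson_law_union assms(2)])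
  finally show ?thesis .
qed

lemma integral_num_vertices_eq_integral_missed_mass:
  assumes diffuse: "\<And>y. emeasure mu {y} = 0"
    and P: "poisson_law mu t P" and Q: "poisson_law mu (x * t) Q"
  shows "(\<integral>S. x ^ num_vertices S \<partial>P) = (\<integral>K. exp (t * (x - 1) * missed_mass mu K) \<partial>Q)"
proof -
  note [measurable] = measurable_missed_mass[OF sigma_finite_measure_axioms sets_mu]
  note [measurable_cong] = poisson_law_sets[OF P] poisson_law_sets[OF Q]
  have "(\<integral>S. x ^ num_vertices S \<partial>P) = enn2real (\<integral>\<^sup>+ S. ennreal (x ^ num_vertices S) \<partial>P)"
    using x_nonneg by (intro integral_eq_nn_integral) auto
  also have "(\<integral>\<^sup>+ S. ennreal (x ^ num_vertices S) \<partial>P)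
      = (\<integral>\<^sup>+ K. ennreal (exp (t * (x - 1) * missed_mass mu K)) \<partial>Q)"
    using emeasure_coupling_hull_covers_num_vertices[OF diffuse P]
      emeasure_coupling_hull_covers_missed_mass[OF Q] by simp
  also have "enn2real \<dots> = (\<integral>K. exp (t * (x - 1) * missed_mass mu K) \<partial>Q)"
    by (intro integral_eq_nn_integral[symmetric]) auto
  finally show ?thesis .
qed

end

theorem theorem4:
  fixes mu :: "'a::euclidean_space measure"
    and M :: "'w measure" and eta :: "'w \<Rightarrow> 'a set"
    and M' :: "'v measure" and eta' :: "'v \<Rightarrow> 'a set"
    and t x :: real
  assumes "prob_space mu" and "sets mu = sets borel"
    and "absolutely_continuous lborel mu"
    and "t > 0"
    and "x \<in> {0..1}"
    and "poisson_point_process M eta mu t"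
    and "poisson_point_process M' eta' mu (x * t)"
  shows "prob_space.expectation M (\<lambda>w. x ^ num_vertices (eta w))
       = prob_space.expectation M' (\<lambda>w. exp (t * (x - 1) * missed_mass mu (eta' w)))"
proof -
  interpret poisson_thinning mu t x
    using assms by (simp add: poisson_thinning_def poisson_thinning_axioms_def)
  note [measurable] = measurable_missed_mass[OF sigma_finite_measure_axioms sets_mu]
    assms(6,7)[THEN poisson_point_process_measurable]
  have diffuse: "emeasure mu {y} = 0" for y
    using absolutely_continuousD[OF assms(3), of "{y}"] by simp
  have "prob_space.expectation M (\<lambda>w. x ^ num_vertices (eta w))
      = (\<integral>S. x ^ num_vertices S \<partial>distr M config eta)"
    by (intro integral_distr[symmetric]) measurable
  also have "\<dots> = (\<integral>K. exp (t * (x - 1) * missed_mass mu K) \<partial>distr M' config eta')"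
    using diffuse assms(6,7)[THEN poisson_law_distr_poisson_point_process]
    by (rule integral_num_vertices_eq_integral_missed_mass)
  also have "\<dots> = prob_space.expectation M' (\<lambda>w. exp (t * (x - 1) * missed_mass mu (eta' w)))"
    by (intro integral_distr) measurable
  finally show ?thesis .
qed

end
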